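(* Let $(X,\delta)$ be a diversity, let $T_X$ be its tight span, and let $\delta_T:\mathcal{P}_{\mathrm{fin}}(T_X)\to\mathbb{R}$ be defined by $\delta_T(\emptyset)=0$ and, for every finite non-empty $F\subseteq T_X$, $$\delta_T(F)=\sup_{\mathscr{A}\subseteq\mathcal{P}_{\mathrm{fin}}(X),\ |\mathscr{A}|<\infty}\left\{\delta\Big(\bigcup_{A\in\mathscr{A}}A\Big)-\sum_{A\in\mathscr{A}}\inf_{f\in F}f(A)\right\}.$$ Then $(T_X,\delta_T)$ is a diversity.
   Context: For a set $X$, $\mathcal{P}_{\mathrm{fin}}(X)$ denotes the set of all finite subsets of $X$. A diversity is a pair $(X,\delta)$ where $X$ is a set and $\delta:\mathcal{P}_{\mathrm{fin}}(X)\to\mathbb{R}$ satisfies, for all finite $A,B,C\subseteq X$: (D1) $\delta(A)\ge 0$, and $\delta(A)=0$ if and only if $|A|\le 1$; (D2) if $B\ne\emptyset$ then $\delta(A\cup C)\le\delta(A\cup B)+\delta(B\cup C)$. Given a diversity $(X,\delta)$, $P_X$ is the set of all functions $f:\mathcal{P}_{\mathrm{fin}}(X)\to\mathbb{R}$ with $f(\emptyset)=0$ and $\sum_{A\in\mathscr{A}}f(A)\ge\delta\big(\bigcup_{A\in\mathscr{A}}A\big)$ for all finite $\mathscr{A}\subseteq\mathcal{P}_{\mathrm{fin}}(X)$. Write $f\preceq g$ if $f(A)\le g(A)$ for all finite $A\subseteq X$. The tight span $T_X$ of $(X,\delta)$ is the set of those elements of $P_X$ that are minimal with respect to $\preceq$.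 *)

theory Defs
  imports Complex_Main "HOL-Library.FuncSet"
begin

text \<open>
  \<^term>\<open>Fpow X\<close> is the set of all finite subsets of \<open>X\<close>. The values of \<open>\<delta>\<close> outside
  \<^term>\<open>Fpow X\<close> are irrelevant.
\<close>

locale diversity =
  fixes X :: "'a set" and \<delta> :: "'a set \<Rightarrow> real"
  assumes nonneg: "A \<in> Fpow X \<Longrightarrow> 0 \<le> \<delta> A"
    and eq_0_iff: "A \<in> Fpow X \<Longrightarrow> \<delta> A = 0 \<longleftrightarrow> card A \<le> 1"
    and triangle: "\<lbrakk>A \<in> Fpow X; B \<in> Fpow X; C \<in> Fpow X; B \<noteq> {}\<rbrakk>
      \<Longrightarrow> \<delta> (A \<union> C) \<le> \<delta> (A \<union> B) + \<delta> (B \<union> C)"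

text \<open>
  Functions \<open>\<P>\<^sub>f\<^sub>i\<^sub>n(X) \<rightarrow> \<real>\<close> are represented by extensional functions (equal to
  \<^term>\<open>undefined\<close> outside \<^term>\<open>Fpow X\<close>), so that HOL equality of such functions, and hence
  the cardinality of sets of them, is the intended one.
\<close>

definition P_space :: "'a set \<Rightarrow> ('a set \<Rightarrow> real) \<Rightarrow> ('a set \<Rightarrow> real) set" where
  "P_space X \<delta> = {f \<in> Fpow X \<rightarrow>\<^sub>E UNIV. f {} = 0 \<and>
     (\<forall>\<A> \<in> Fpow (Fpow X). (\<Sum>A\<in>\<A>. f A) \<ge> \<delta> (\<Union>\<A>))}"

definition pointwise_le :: "'a set \<Rightarrow> ('a set \<Rightarrow> real) \<Rightarrow> ('a set \<Rightarrow> real) \<Rightarrow> bool" where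
  "pointwise_le X f g \<longleftrightarrow> (\<forall>A \<in> Fpow X. f A \<le> g A)"

definition tight_span :: "'a set \<Rightarrow> ('a set \<Rightarrow> real) \<Rightarrow> ('a set \<Rightarrow> real) set" where
  "tight_span X \<delta> = {f \<in> P_space X \<delta>. \<forall>g \<in> P_space X \<delta>. pointwise_le X g f \<longrightarrow> g = f}"

definition delta_T_set ::
  "'a set \<Rightarrow> ('a set \<Rightarrow> real) \<Rightarrow> ('a set \<Rightarrow> real) set \<Rightarrow> real set" where
  "delta_T_set X \<delta> F =
     {\<delta> (\<Union>\<A>) - (\<Sum>A\<in>\<A>. INF f\<in>F. f A) | \<A>. \<A> \<in> Fpow (Fpow X)}"

text \<open>
  \<^const>\<open>Sup\<close> on the reals is a genuine supremum only for nonempty sets that are bounded above.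
  \<^term>\<open>delta_T_set X \<delta> F\<close> is never empty (take \<open>\<A> = {}\<close>), but its boundedness, i.e. that
  \<open>\<delta>\<^sub>T\<close> really takes values in \<open>\<real>\<close>, is not built into the definition.
\<close>

definition delta_T ::
  "'a set \<Rightarrow> ('a set \<Rightarrow> real) \<Rightarrow> ('a set \<Rightarrow> real) set \<Rightarrow> real" where
  "delta_T X \<delta> F = (if F = {} then 0 else Sup (delta_T_set X \<delta> F))"

end

theory Submission
  imports Defs
begin

text \<open>
  Write \<open>m\<^sub>F(A) = inf\<^sub>f\<^sub>\<in>\<^sub>F f(A)\<close>. The proof rests on two observations.

  First, for finite nonempty \<open>F\<close> and \<open>H\<close>, since \<open>m\<^sub>F\<^sub>\<union>\<^sub>H(A)\<close> is one of \<open>m\<^sub>F(A)\<close>, \<open>m\<^sub>H(A)\<close>, every finite family splits into two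
  parts on which \<open>m\<^sub>F\<^sub>\<union>\<^sub>H\<close> agrees with \<open>m\<^sub>F\<close> and with \<open>m\<^sub>H\<close> respectively
  (\<open>sum_INF_Un_split\<close>). Joining the unions of the two parts through a single point of \<open>X\<close>
  bounds the set defining \<open>\<delta>\<^sub>T\<close>, by induction on the size of \<open>F\<close> (\<open>bdd_above_delta_T_set\<close>).

  Second, if \<open>g\<close> is minimal, then no value \<open>g(A)\<close> with \<open>A \<noteq> \<emptyset>\<close> can be lowered within
  \<open>P\<^sub>X\<close>, so some inequality defining \<open>P\<^sub>X\<close> and involving \<open>g(A)\<close> is tight up to an arbitrarily
  small error (\<open>tight_span_nearly_attained\<close>). Adding the other members of that
  inequality's family to a family \<open>\<A>\<close> gives
  \<open>\<delta>\<^sub>T(F \<union> {g}) \<ge> g(\<Union>\<A>) - \<Sum>\<^sub>A\<^sub>\<in>\<^sub>\<A> m\<^sub>F(A)\<close> (\<open>delta_T_insert_ge\<close>).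

  The triangle inequality follows. As \<open>\<delta>\<^sub>T\<close> is monotone, it suffices to pass through a single
  \<open>g\<close>. Splitting a family for \<open>F \<union> H\<close> into parts with unions \<open>U\<close> and \<open>V\<close>, the
  bounds for the two parts add up to the required one because
  \<open>\<delta>(U \<union> V) \<le> g(U) + g(V)\<close>. Finally, for nonempty \<open>F\<close>, \<open>\<delta>\<^sub>T(F) = 0\<close> says exactly that \<open>m\<^sub>F\<close> lies in \<open>P\<^sub>X\<close>;
  as \<open>m\<^sub>F\<close> is below every member of \<open>F\<close>, minimality forces all of these to equal \<open>m\<^sub>F\<close>.
\<close>

section \<open>Finite sets, sums and infima\<close>

lemma Fpow_Un: "A \<in> Fpow X \<Longrightarrow> B \<in> Fpow X \<Longrightarrow> A \<union> B \<in> Fpow X"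
  by (auto simp: Fpow_def)

lemma Union_in_Fpow: "\<A> \<in> Fpow (Fpow X) \<Longrightarrow> \<Union>\<A> \<in> Fpow X"
  by (auto simp: Fpow_def)

lemma finite_Fpow: "A \<in> Fpow X \<Longrightarrow> finite A"
  by (simp add: Fpow_def)

lemma Fpow_subset: "A \<in> Fpow X \<Longrightarrow> B \<subseteq> A \<Longrightarrow> B \<in> Fpow X"
  by (auto simp: Fpow_def intro: finite_subset)

text \<open>
  The infimum over \<open>F \<union> H\<close> is the smaller of the infima over \<open>F\<close> and \<open>H\<close>; sorting
  the members of the family by which of the two is smaller gives the splitting.
\<close>

lemma sum_INF_Un_split:
  fixes F H :: "('b \<Rightarrow> real) set"
  assumes "finite F" "F \<noteq> {}" "finite H" "H \<noteq> {}" "finite \<A>"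
  obtains \<B> \<C> where "\<A> = \<B> \<union> \<C>"
    "(\<Sum>A\<in>\<A>. INF f\<in>F \<union> H. f A) = (\<Sum>A\<in>\<B>. INF f\<in>F. f A) + (\<Sum>A\<in>\<C>. INF f\<in>H. f A)"
proof
  let ?F = "\<lambda>A. INF f\<in>F. f A" and ?H = "\<lambda>A. INF f\<in>H. f A"
  let ?B = "{A\<in>\<A>. ?F A \<le> ?H A}" and ?C = "{A\<in>\<A>. \<not> ?F A \<le> ?H A}"
  show eq: "\<A> = ?B \<union> ?C" by auto
  have *: "(INF f\<in>F \<union> H. f A) = min (?F A) (?H A)" for A
    using assms by (simp add: cINF_union inf_min)
  have "(\<Sum>A\<in>\<A>. INF f\<in>F \<union> H. f A) = (\<Sum>A\<in>?B \<union> ?C. min (?F A) (?H A))"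
    using eq * by simp
  also have "\<dots> = (\<Sum>A\<in>?B. min (?F A) (?H A)) + (\<Sum>A\<in>?C. min (?F A) (?H A))"
    using \<open>finite \<A>\<close> by (intro sum.union_disjoint) auto
  also have "\<dots> = (\<Sum>A\<in>?B. ?F A) + (\<Sum>A\<in>?C. ?H A)"
    by (intro arg_cong2[where f = "(+)"] sum.cong) auto
  finally show "(\<Sum>A\<in>\<A>. INF f\<in>F \<union> H. f A) = (\<Sum>A\<in>?B. ?F A) + (\<Sum>A\<in>?C. ?H A)" .
qed

lemma sum_Un_le_add:
  fixes f :: "'b \<Rightarrow> real"
  assumes "finite \<A>" "finite \<B>" "\<And>A. A \<in> \<A> \<inter> \<B> \<Longrightarrow> 0 \<le> f A"
  shows "sum f (\<A> \<union> \<B>) \<le> sum f \<A> + sum f \<B>"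
  using sum.union_inter[OF assms(1,2), of f] sum_nonneg[of "\<A> \<inter> \<B>" f] assms(3) by simp

section \<open>The tight span\<close>

lemma delta_T_setI:
  "\<A> \<in> Fpow (Fpow X) \<Longrightarrow> \<delta> (\<Union>\<A>) - (\<Sum>A\<in>\<A>. INF f\<in>F. f A) \<in> delta_T_set X \<delta> F"
  by (auto simp: delta_T_set_def)

lemma tight_span_in_P_space: "f \<in> tight_span X \<delta> \<Longrightarrow> f \<in> P_space X \<delta>"
  by (simp add: tight_span_def)

context diversity
begin

lemma delta_empty: "\<delta> {} = 0"
  by (simp add: eq_0_iff Fpow_def)

lemma P_space_empty: "f \<in> P_space X \<delta> \<Longrightarrow> f {} = 0"
  by (simp add: P_space_def)

lemma P_space_sum_ge: "f \<in> P_space X \<delta> \<Longrightarrow> \<A> \<in> Fpow (Fpow X) \<Longrightarrow> \<delta> (\<Union>\<A>) \<le> sum f \<A>"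
  by (simp add: P_space_def)

lemma P_space_ge:
  assumes "f \<in> P_space X \<delta>" "A \<in> Fpow X" shows "\<delta> A \<le> f A"
  using P_space_sum_ge[OF assms(1), of "{A}"] assms(2) by (simp add: Fpow_def)

lemma P_space_nonneg: "f \<in> P_space X \<delta> \<Longrightarrow> A \<in> Fpow X \<Longrightarrow> 0 \<le> f A"
  using P_space_ge nonneg by fastforce

lemma P_space_Un_ge:
  assumes f: "f \<in> P_space X \<delta>" and U: "U \<in> Fpow X" and V: "V \<in> Fpow X"
  shows "\<delta> (U \<union> V) \<le> f U + f V"
proof (cases "U = V")
  case True
  then show ?thesis using P_space_ge[OF f U] P_space_nonneg[OF f V] by simp
next
  case False
  then show ?thesis using P_space_sum_ge[OF f, of "{U, V}"] U V by (simp add: Fpow_def)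
qed

lemma INF_nonneg:
  assumes "F \<in> Fpow (tight_span X \<delta>)" "F \<noteq> {}" "A \<in> Fpow X"
  shows "0 \<le> (INF f\<in>F. f A)"
  using assms by (intro cINF_greatest)
    (auto intro!: P_space_nonneg tight_span_in_P_space simp: Fpow_def[of "tight_span X \<delta>"])

text \<open>
  If every inequality involving \<open>g(A)\<close> had slack at least \<open>e\<close>, then lowering \<open>g(A)\<close> by \<open>e\<close> would
  give a smaller element of \<open>P\<^sub>X\<close>. The case \<open>A = \<emptyset>\<close> is separate, as \<open>g(\<emptyset>)\<close> is fixed at \<open>0\<close>.
\<close>

lemma tight_span_nearly_attained:
  assumes g: "g \<in> tight_span X \<delta>" and A: "A \<in> Fpow X" and e: "e > 0"
  obtains \<B> where "\<B> \<in> Fpow (Fpow X)" "g A - e < \<delta> (A \<union> \<Union>\<B>) - sum g \<B>"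
proof (cases "A = {}")
  case True
  show thesis
    by (rule that[of "{}"]) (use True e P_space_empty[OF tight_span_in_P_space[OF g]]
        in \<open>auto simp: Fpow_def delta_empty\<close>)
next
  case False
  note gP = tight_span_in_P_space[OF g]
  have "\<exists>\<B>\<in>Fpow (Fpow X). g A - e < \<delta> (A \<union> \<Union>\<B>) - sum g \<B>"
  proof (rule ccontr)
    assume "\<not> ?thesis"
    then have slack: "\<delta> (A \<union> \<Union>\<B>) - sum g \<B> \<le> g A - e" if "\<B> \<in> Fpow (Fpow X)" for \<B>
      using that by force
    define h where "h = g(A := g A - e)"
    have "h \<in> P_space X \<delta>"
      unfolding P_space_def
    proof (intro CollectI conjI ballI)
      show "h \<in> Fpow X \<rightarrow>\<^sub>E UNIV"
        using gP A by (auto simp: h_def P_space_def PiE_def extensional_def)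
      show "h {} = 0"
        using P_space_empty[OF gP] False by (simp add: h_def)
      fix \<A> assume \<A>: "\<A> \<in> Fpow (Fpow X)"
      show "\<delta> (\<Union>\<A>) \<le> sum h \<A>"
      proof (cases "A \<in> \<A>")
        case True
        have "sum h \<A> = h A + sum h (\<A> - {A})"
          using True finite_Fpow[OF \<A>] by (rule sum.remove[rotated])
        also have "\<dots> = g A - e + sum g (\<A> - {A})"
          by (simp add: h_def)
        also have "\<dots> \<ge> \<delta> (A \<union> \<Union>(\<A> - {A}))"
          using slack[OF Fpow_subset[OF \<A>, of "\<A> - {A}"]] by auto
        also have "A \<union> \<Union>(\<A> - {A}) = \<Union>\<A>" using True by auto
        finally show ?thesis .
      next
        case False
        then have "sum h \<A> = sum g \<A>"
          by (intro sum.cong) (auto simp: h_def)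
        then show ?thesis using P_space_sum_ge[OF gP \<A>] by simp
      qed
    qed
    moreover have "pointwise_le X h g"
      using e by (auto simp: pointwise_le_def h_def)
    ultimately have "h = g" using g by (auto simp: tight_span_def)
    then have "h A = g A" by simp
    then show False using e by (simp add: h_def)
  qed
  then show thesis using that by blast
qed

section \<open>Finiteness and monotonicity of the supremum\<close>

text \<open>
  For a point \<open>x\<close>, enlarging a family by \<open>{x}\<close> costs at most \<open>m\<^sub>F({x})\<close>, and
  \<open>\<delta>(U \<union> V) \<le> \<delta>(U \<union> {x}) + \<delta>({x} \<union> V)\<close>. Hence the bound for \<open>F \<union> {f}\<close> exceeds the sum of
  those for \<open>F\<close> and \<open>{f}\<close> by at most \<open>m\<^sub>F({x}) + f({x})\<close>; for a singleton the bound is \<open>0\<close>.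
\<close>

lemma bdd_above_delta_T_set:
  assumes F: "F \<in> Fpow (tight_span X \<delta>)" "F \<noteq> {}"
  shows "bdd_above (delta_T_set X \<delta> F)"
proof (cases "X = {}")
  case True
  show ?thesis
  proof (rule bdd_aboveI[of _ 0])
    fix r assume "r \<in> delta_T_set X \<delta> F"
    then obtain \<A> where \<A>: "\<A> \<in> Fpow (Fpow X)"
      and r: "r = \<delta> (\<Union>\<A>) - (\<Sum>A\<in>\<A>. INF f\<in>F. f A)"
      by (auto simp: delta_T_set_def)
    have "\<Union>\<A> = {}" using Union_in_Fpow[OF \<A>] True by (simp add: Fpow_def)
    moreover have "0 \<le> (\<Sum>A\<in>\<A>. INF f\<in>F. f A)"
      using \<A> by (intro sum_nonneg INF_nonneg[OF F]) (auto simp: Fpow_def)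
    ultimately show "r \<le> 0" unfolding r by (simp only: delta_empty)
  qed
next
  case False
  then obtain x where x: "{x} \<in> Fpow X" by (auto simp: Fpow_def)
  from F have "finite F" "F \<noteq> {}" "F \<subseteq> tight_span X \<delta>" by (auto simp: Fpow_def)
  then show ?thesis
  proof (induction F rule: finite_ne_induct)
    case (singleton f)
    then have "f \<in> P_space X \<delta>" by (simp add: tight_span_in_P_space)
    then show ?case
      by (intro bdd_aboveI[of _ 0]) (auto simp: delta_T_set_def dest: P_space_sum_ge)
  next
    case (insert f F)
    then have fP: "f \<in> P_space X \<delta>" and FT: "F \<in> Fpow (tight_span X \<delta>)"
      by (auto simp: tight_span_in_P_space Fpow_def)
    let ?m = "\<lambda>A. INF f\<in>F. f A"
    from insert obtain M where M: "\<And>r. r \<in> delta_T_set X \<delta> F \<Longrightarrow> r \<le> M"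
      by (auto simp: bdd_above_def)
    show ?case
    proof (rule bdd_aboveI[of _ "M + ?m {x} + f {x}"])
      fix r assume "r \<in> delta_T_set X \<delta> (insert f F)"
      then obtain \<A> where \<A>: "\<A> \<in> Fpow (Fpow X)"
        and r: "r = \<delta> (\<Union>\<A>) - (\<Sum>A\<in>\<A>. INF h\<in>F \<union> {f}. h A)"
        by (auto simp: delta_T_set_def)
      obtain \<B> \<C> where split: "\<A> = \<B> \<union> \<C>"
          "(\<Sum>A\<in>\<A>. INF h\<in>F \<union> {f}. h A) = (\<Sum>A\<in>\<B>. ?m A) + (\<Sum>A\<in>\<C>. INF h\<in>{f}. h A)"
        using sum_INF_Un_split[of F "{f}" \<A>] insert.hyps finite_Fpow[OF \<A>]
        by (metis finite.emptyI finite_insert insert_not_empty)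
      have \<B>: "\<B> \<in> Fpow (Fpow X)" and \<C>: "\<C> \<in> Fpow (Fpow X)"
        using Fpow_subset[OF \<A>] split(1) by auto
      have xs: "{{x}} \<in> Fpow (Fpow X)" using x by (simp add: Fpow_def)
      have "\<delta> (\<Union>\<B> \<union> {x}) \<le> M + (\<Sum>A\<in>\<B> \<union> {{x}}. ?m A)"
        using M[OF delta_T_setI[OF Fpow_Un[OF \<B> xs]]] by (simp add: Un_commute)
      also have "\<dots> \<le> M + ((\<Sum>A\<in>\<B>. ?m A) + ?m {x})"
        using sum_Un_le_add[of \<B> "{{x}}" ?m] finite_Fpow[OF \<B>]
          INF_nonneg[OF FT insert.hyps(2) x] by auto
      finally have 1: "\<delta> (\<Union>\<B> \<union> {x}) \<le> M + (\<Sum>A\<in>\<B>. ?m A) + ?m {x}" by simp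
      have "\<delta> ({x} \<union> \<Union>\<C>) \<le> sum f (\<C> \<union> {{x}})"
        using P_space_sum_ge[OF fP Fpow_Un[OF \<C> xs]] by (simp add: Un_commute)
      also have "\<dots> \<le> sum f \<C> + f {x}"
        using sum_Un_le_add[of \<C> "{{x}}" f] finite_Fpow[OF \<C>] P_space_nonneg[OF fP x] by auto
      finally have 2: "\<delta> ({x} \<union> \<Union>\<C>) \<le> sum f \<C> + f {x}" .
      have "\<delta> (\<Union>\<B> \<union> \<Union>\<C>) \<le> \<delta> (\<Union>\<B> \<union> {x}) + \<delta> ({x} \<union> \<Union>\<C>)"
        using triangle[OF Union_in_Fpow[OF \<B>] x Union_in_Fpow[OF \<C>]] by simp
      with 1 2 show "r \<le> M + ?m {x} + f {x}" using r split by (simp add: Union_Un_distrib)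
    qed
  qed
qed

lemma delta_T_ge:
  assumes "F \<in> Fpow (tight_span X \<delta>)" "F \<noteq> {}" "\<A> \<in> Fpow (Fpow X)"
  shows "\<delta> (\<Union>\<A>) - (\<Sum>A\<in>\<A>. INF f\<in>F. f A) \<le> delta_T X \<delta> F"
  using cSup_upper[OF delta_T_setI[OF assms(3)] bdd_above_delta_T_set[OF assms(1,2)]] assms(2)
  by (simp add: delta_T_def)

lemma delta_T_le:
  assumes "F \<noteq> {}"
    and "\<And>\<A>. \<A> \<in> Fpow (Fpow X) \<Longrightarrow> \<delta> (\<Union>\<A>) - (\<Sum>A\<in>\<A>. INF f\<in>F. f A) \<le> c"
  shows "delta_T X \<delta> F \<le> c"
proof -
  have "{} \<in> Fpow (Fpow X)" by (simp add: Fpow_def)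
  from delta_T_setI[OF this] have "delta_T_set X \<delta> F \<noteq> {}" by blast
  then have "Sup (delta_T_set X \<delta> F) \<le> c"
    by (rule cSup_least) (use assms(2) in \<open>auto simp: delta_T_set_def\<close>)
  then show ?thesis using assms(1) by (simp add: delta_T_def)
qed

lemma delta_T_nonneg: "F \<in> Fpow (tight_span X \<delta>) \<Longrightarrow> 0 \<le> delta_T X \<delta> F"
  using delta_T_ge[of F "{}"] by (cases "F = {}") (auto simp: delta_T_def delta_empty Fpow_def)

lemma delta_T_mono:
  assumes G: "G \<in> Fpow (tight_span X \<delta>)" and "F \<subseteq> G"
  shows "delta_T X \<delta> F \<le> delta_T X \<delta> G"
proof (cases "F = {}")
  case True
  then show ?thesis using delta_T_nonneg[OF G] by (simp add: delta_T_def)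
next
  case False
  show ?thesis
  proof (rule delta_T_le[OF False])
    fix \<A> assume \<A>: "\<A> \<in> Fpow (Fpow X)"
    have "(\<Sum>A\<in>\<A>. INF f\<in>G. f A) \<le> (\<Sum>A\<in>\<A>. INF f\<in>F. f A)"
      using False \<open>F \<subseteq> G\<close> finite_Fpow[OF G] by (intro sum_mono cINF_superset_mono) auto
    then show "\<delta> (\<Union>\<A>) - (\<Sum>A\<in>\<A>. INF f\<in>F. f A) \<le> delta_T X \<delta> G"
      using delta_T_ge[OF G _ \<A>] False \<open>F \<subseteq> G\<close> by fastforce
  qed
qed

section \<open>The triangle inequality\<close>

text \<open>
  Choose \<open>\<B>\<close> with \<open>g(\<Union>\<A>)\<close> nearly equal to \<open>\<delta>(\<Union>\<A> \<union> \<Union>\<B>) - \<Sum>\<^sub>B\<^sub>\<in>\<^sub>\<B> g(B)\<close> and test \<open>\<delta>\<^sub>T\<close> on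
  \<open>\<A> \<union> \<B>\<close>: the infimum over \<open>F \<union> {g}\<close> is at most \<open>m\<^sub>F\<close> on \<open>\<A>\<close> and at most \<open>g\<close> on \<open>\<B>\<close>.
\<close>

lemma delta_T_insert_ge:
  assumes F: "F \<in> Fpow (tight_span X \<delta>)" "F \<noteq> {}" and g: "g \<in> tight_span X \<delta>"
    and \<A>: "\<A> \<in> Fpow (Fpow X)"
  shows "g (\<Union>\<A>) - (\<Sum>A\<in>\<A>. INF f\<in>F. f A) \<le> delta_T X \<delta> (insert g F)"
proof (rule field_le_epsilon)
  fix e :: real assume "e > 0"
  then obtain \<B> where \<B>: "\<B> \<in> Fpow (Fpow X)"
    and near: "g (\<Union>\<A>) - e < \<delta> (\<Union>\<A> \<union> \<Union>\<B>) - sum g \<B>"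
    using tight_span_nearly_attained[OF g Union_in_Fpow[OF \<A>]] by blast
  let ?G = "insert g F"
  let ?m = "\<lambda>A. INF f\<in>?G. f A"
  have G: "?G \<in> Fpow (tight_span X \<delta>)" using F g by (simp add: Fpow_def)
  note fin = finite_Fpow[OF G] finite_Fpow[OF \<A>] finite_Fpow[OF \<B>]
  have "sum ?m (\<A> \<union> \<B>) \<le> sum ?m \<A> + sum ?m \<B>"
    using fin \<A> by (intro sum_Un_le_add INF_nonneg[OF G]) (auto simp: Fpow_def)
  also have "sum ?m \<A> \<le> (\<Sum>A\<in>\<A>. INF f\<in>F. f A)"
    using F(2) fin by (intro sum_mono cINF_superset_mono) auto
  also have "sum ?m \<B> \<le> sum g \<B>"
    using fin by (intro sum_mono cINF_lower) auto
  finally have "sum ?m (\<A> \<union> \<B>) \<le> (\<Sum>A\<in>\<A>. INF f\<in>F. f A) + sum g \<B>" by simp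
  then show "g (\<Union>\<A>) - (\<Sum>A\<in>\<A>. INF f\<in>F. f A) \<le> delta_T X \<delta> ?G + e"
    using near delta_T_ge[OF G _ Fpow_Un[OF \<A> \<B>]] by (simp add: Union_Un_distrib)
qed

lemma delta_T_triangle_point:
  assumes F: "F \<in> Fpow (tight_span X \<delta>)" "F \<noteq> {}" and H: "H \<in> Fpow (tight_span X \<delta>)" "H \<noteq> {}"
    and g: "g \<in> tight_span X \<delta>"
  shows "delta_T X \<delta> (F \<union> H) \<le> delta_T X \<delta> (insert g F) + delta_T X \<delta> (insert g H)"
proof (rule delta_T_le)
  show "F \<union> H \<noteq> {}" using F by simp
  fix \<A> assume \<A>: "\<A> \<in> Fpow (Fpow X)"
  obtain \<B> \<C> where split: "\<A> = \<B> \<union> \<C>"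
      "(\<Sum>A\<in>\<A>. INF f\<in>F \<union> H. f A) = (\<Sum>A\<in>\<B>. INF f\<in>F. f A) + (\<Sum>A\<in>\<C>. INF f\<in>H. f A)"
    using sum_INF_Un_split[OF finite_Fpow[OF F(1)] F(2) finite_Fpow[OF H(1)] H(2) finite_Fpow[OF \<A>]] .
  have \<B>: "\<B> \<in> Fpow (Fpow X)" and \<C>: "\<C> \<in> Fpow (Fpow X)"
    using Fpow_subset[OF \<A>] split(1) by auto
  have "\<delta> (\<Union>\<B> \<union> \<Union>\<C>) \<le> g (\<Union>\<B>) + g (\<Union>\<C>)"
    by (intro P_space_Un_ge tight_span_in_P_space g Union_in_Fpow \<B> \<C>)
  then show "\<delta> (\<Union>\<A>) - (\<Sum>A\<in>\<A>. INF f\<in>F \<union> H. f A)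
      \<le> delta_T X \<delta> (insert g F) + delta_T X \<delta> (insert g H)"
    using delta_T_insert_ge[OF F g \<B>] delta_T_insert_ge[OF H g \<C>] split
    by (simp add: Union_Un_distrib)
qed

lemma delta_T_triangle:
  assumes F: "F \<in> Fpow (tight_span X \<delta>)" and G: "G \<in> Fpow (tight_span X \<delta>)"
    and H: "H \<in> Fpow (tight_span X \<delta>)" and "G \<noteq> {}"
  shows "delta_T X \<delta> (F \<union> H) \<le> delta_T X \<delta> (F \<union> G) + delta_T X \<delta> (G \<union> H)"
proof -
  obtain g where "g \<in> G" using \<open>G \<noteq> {}\<close> by blast
  then have g: "g \<in> tight_span X \<delta>" using G by (auto simp: Fpow_def)
  note FG = Fpow_Un[OF F G] and GH = Fpow_Un[OF G H]
  consider "F = {}" | "H = {}" | "F \<noteq> {}" "H \<noteq> {}" by blast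
  then show ?thesis
  proof cases
    case 1
    then show ?thesis using delta_T_mono[OF GH, of H] delta_T_nonneg[OF FG] by simp
  next
    case 2
    then show ?thesis using delta_T_mono[OF FG, of F] delta_T_nonneg[OF GH] by simp
  next
    case 3
    have "delta_T X \<delta> (insert g F) \<le> delta_T X \<delta> (F \<union> G)"
      "delta_T X \<delta> (insert g H) \<le> delta_T X \<delta> (G \<union> H)"
      using \<open>g \<in> G\<close> by (intro delta_T_mono FG GH; auto)+
    then show ?thesis using delta_T_triangle_point[OF F 3(1) H 3(2) g] by simp
  qed
qed

section \<open>Vanishing of the tight span diversity\<close>

text \<open>
  For a singleton, the inequalities defining \<open>P\<^sub>X\<close> bound \<open>\<delta>\<^sub>T\<close> by \<open>0\<close>. Conversely, if \<open>\<delta>\<^sub>T(F) = 0\<close>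
  then the pointwise infimum of \<open>F\<close> lies in \<open>P\<^sub>X\<close>, below every element of \<open>F\<close>.
\<close>

lemma delta_T_eq_0_iff:
  assumes F: "F \<in> Fpow (tight_span X \<delta>)"
  shows "delta_T X \<delta> F = 0 \<longleftrightarrow> card F \<le> 1"
proof (cases "F = {}")
  case True
  then show ?thesis by (simp add: delta_T_def)
next
  case False
  show ?thesis
  proof
    assume zero: "delta_T X \<delta> F = 0"
    define h where "h = restrict (\<lambda>A. INF f\<in>F. f A) (Fpow X)"
    have "h \<in> P_space X \<delta>"
      unfolding P_space_def
    proof (intro CollectI conjI ballI)
      show "h \<in> Fpow X \<rightarrow>\<^sub>E UNIV" by (simp add: h_def)
      have "f {} = 0" if "f \<in> F" for f
        using F that by (auto simp: Fpow_def intro: P_space_empty tight_span_in_P_space)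
      then have "(INF f\<in>F. f {}) = (INF f\<in>F. 0)" by (intro INF_cong) auto
      then show "h {} = 0" using False by (simp add: h_def Fpow_def)
      fix \<A> assume \<A>: "\<A> \<in> Fpow (Fpow X)"
      have "sum h \<A> = (\<Sum>A\<in>\<A>. INF f\<in>F. f A)"
        using \<A> by (intro sum.cong) (auto simp: h_def Fpow_def)
      then show "\<delta> (\<Union>\<A>) \<le> sum h \<A>"
        using delta_T_ge[OF F False \<A>] zero by simp
    qed
    moreover have "pointwise_le X h f" if "f \<in> F" for f
      using that finite_Fpow[OF F] by (auto simp: pointwise_le_def h_def intro!: cINF_lower)
    ultimately have "h = f" if "f \<in> F" for f
      using that F by (auto simp: tight_span_def Fpow_def)
    then have "F \<subseteq> {h}" by auto
    then show "card F \<le> 1" using card_mono[of "{h}" F] by simp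
  next
    assume "card F \<le> 1"
    then obtain f where f: "F = {f}"
      using False finite_Fpow[OF F] by (metis card_0_eq card_1_singletonE le_antisym less_one linorder_not_less)
    then have "f \<in> P_space X \<delta>" using F by (simp add: Fpow_def tight_span_in_P_space)
    then have "delta_T X \<delta> F \<le> 0"
      by (intro delta_T_le[OF False]) (simp add: f P_space_sum_ge)
    then show "delta_T X \<delta> F = 0" using delta_T_nonneg[OF F] by simp
  qed
qed

end

theorem theorem2p7:
  fixes X :: "'a set" and \<delta> :: "'a set \<Rightarrow> real"
  assumes "diversity X \<delta>"
  shows "(\<forall>F \<in> Fpow (tight_span X \<delta>). F \<noteq> {} \<longrightarrow> bdd_above (delta_T_set X \<delta> F))
    \<and> diversity (tight_span X \<delta>) (delta_T X \<delta>)"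
proof -
  interpret diversity X \<delta> by fact
  show ?thesis
    by (intro conjI ballI impI bdd_above_delta_T_set diversity.intro
        delta_T_nonneg delta_T_eq_0_iff delta_T_triangle)
qed

end
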